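(* Let $G$ be a finite metacyclic $p$-group ($p$ a prime). Then there are elements $a,b\in G$ with $\langle a\rangle$ normal in $G$ and $G=\langle a\rangle\langle b\rangle$ such that $G$ is the active sum of the family formed by $\langle a\rangle$ together with all conjugates of $\langle b\rangle$ in $G$.
   Context: A group is metacyclic if it has a normal cyclic subgroup with cyclic quotient. For a group $G$ and a family $\mathcal{F}$ of distinct subgroups that generates $G$ and is closed under conjugation, the active sum $S$ of $\mathcal{F}$ is the free product of the members of $\mathcal{F}$ divided by the normal subgroup generated by all elements $h^{-1}\cdot g\cdot h\cdot (g^h)^{-1}$ with $h\in F_1$, $g\in F_2$, $F_1,F_2\in\mathcal{F}$, where $g^h=h^{-1}gh$ is regarded as an element of the factor $h^{-1}F_2h\in\mathcal{F}$. The inclusions induce a canonical surjection $\varphi:S\to G$, and "$G$ is the active sum of $\mathcal{F}$" means $\varphi$ is an isomorphism. (In the paper, $a$ and $b$ are the generators in the standard presentations of metacyclic $p$-groups due to Sim for odd $p$ and Hempel for $p=2$.) *)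

theory Defs
  imports "HOL-Algebra.Algebra"
begin

definition metacyclic :: "('a, 'b) monoid_scheme \<Rightarrow> bool" where
  "metacyclic G \<longleftrightarrow> (\<exists>N. N \<lhd> G \<and> cyclic_group (subgroup_generated G N) \<and> cyclic_group (G Mod N))"

definition conj_subgroup :: "('a, 'b) monoid_scheme \<Rightarrow> 'a set \<Rightarrow> 'a \<Rightarrow> 'a set" where
  "conj_subgroup G H x = (inv\<^bsub>G\<^esub> x) <#\<^bsub>G\<^esub> H #>\<^bsub>G\<^esub> x"

definition active_family :: "('a, 'b) monoid_scheme \<Rightarrow> 'a set set \<Rightarrow> bool" where
  "active_family G \<F> \<longleftrightarrow> (\<forall>F\<in>\<F>. subgroup F G) \<and> generate G (\<Union>\<F>) = carrier G
     \<and> (\<forall>F\<in>\<F>. \<forall>x\<in>carrier G. conj_subgroup G F x \<in> \<F>)"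

definition fp_word :: "'a set set \<Rightarrow> ('a set \<times> 'a) list \<Rightarrow> bool" where
  "fp_word \<F> w \<longleftrightarrow> (\<forall>(F, g) \<in> set w. F \<in> \<F> \<and> g \<in> F)"

definition fp_eval :: "('a, 'b) monoid_scheme \<Rightarrow> ('a set \<times> 'a) list \<Rightarrow> 'a" where
  "fp_eval G w = foldr (\<lambda>(F, g) acc. g \<otimes>\<^bsub>G\<^esub> acc) w \<one>\<^bsub>G\<^esub>"

text \<open>The congruence on words whose quotient monoid is the active sum S:
  the first two base relations present the free product of the members of the family
  (identity letters vanish, adjacent letters from the same factor multiply),
  the third kills the relators h^-1 g h (g^h)^-1; the congruence closure gives the
  quotient by the normal subgroup they generate.\<close>
inductive asum_eq :: "('a, 'b) monoid_scheme \<Rightarrow> 'a set set \<Rightarrow>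
    ('a set \<times> 'a) list \<Rightarrow> ('a set \<times> 'a) list \<Rightarrow> bool"
  for G :: "('a, 'b) monoid_scheme" and \<F> :: "'a set set" where
  unit: "F \<in> \<F> \<Longrightarrow> asum_eq G \<F> [(F, \<one>\<^bsub>G\<^esub>)] []"
| mult: "F \<in> \<F> \<Longrightarrow> g \<in> F \<Longrightarrow> h \<in> F \<Longrightarrow>
     asum_eq G \<F> [(F, g), (F, h)] [(F, g \<otimes>\<^bsub>G\<^esub> h)]"
| active: "F1 \<in> \<F> \<Longrightarrow> F2 \<in> \<F> \<Longrightarrow> h \<in> F1 \<Longrightarrow> g \<in> F2 \<Longrightarrow>
     asum_eq G \<F>
       [(F1, inv\<^bsub>G\<^esub> h), (F2, g), (F1, h),
        (conj_subgroup G F2 h, inv\<^bsub>G\<^esub> (inv\<^bsub>G\<^esub> h \<otimes>\<^bsub>G\<^esub> g \<otimes>\<^bsub>G\<^esub> h))] []"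
| refl: "asum_eq G \<F> w w"
| sym: "asum_eq G \<F> w v \<Longrightarrow> asum_eq G \<F> v w"
| trans: "asum_eq G \<F> u v \<Longrightarrow> asum_eq G \<F> v w \<Longrightarrow> asum_eq G \<F> u w"
| ctxt: "asum_eq G \<F> w v \<Longrightarrow> asum_eq G \<F> (x @ w @ y) (x @ v @ y)"

text \<open>G is the active sum of the family: the canonical surjection S -> G is injective,
  i.e. words with equal evaluation in G are already equal in S.\<close>
definition is_active_sum :: "('a, 'b) monoid_scheme \<Rightarrow> 'a set set \<Rightarrow> bool" where
  "is_active_sum G \<F> \<longleftrightarrow> active_family G \<F> \<and>
     (\<forall>w v. fp_word \<F> w \<longrightarrow> fp_word \<F> v \<longrightarrow> fp_eval G w = fp_eval G v \<longrightarrow> asum_eq G \<F> w v)"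

end

theory Submission
  imports Defs
begin

text \<open>
  Write \<open>A = \<langle>a\<rangle>\<close> and \<open>B = \<langle>b\<rangle>\<close>. By the conjugation relators every element of the active sum
  \<open>S\<close> is a product of a letter from \<open>A\<close> and one from \<open>B\<close>, so \<open>S \<rightarrow> G\<close> is injective as soon as the
  letters \<open>(A, z)\<close> and \<open>(B, z)\<close> agree in \<open>S\<close> for all \<open>z \<in> A \<inter> B\<close>. If \<open>z = [g, b]\<close> with
  \<open>g \<in> A\<close>, then \<open>g\<close> normalises \<open>B\<close>, and computing \<open>[g, b]\<close> in \<open>S\<close> once in the factor \<open>A\<close> and once
  in the factor \<open>B\<close> identifies the two letters. Hence it suffices that \<open>A \<inter> B\<close> consists of
  commutators \<open>[g, b]\<close> with \<open>g \<in> A\<close>.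

  A pair \<open>a, b\<close> with \<open>A\<close> normal, \<open>G = AB\<close> and \<open>|A \<inter> B|\<close> minimal has this property, possibly after
  exchanging \<open>a\<close> and \<open>b\<close>. Subgroups of \<open>A\<close> form a chain, so otherwise all those commutators
  lie in \<open>C = \<langle>a ^ (p ^ (t + 1))\<rangle>\<close>, where \<open>A \<inter> B = \<langle>a ^ (p ^ t)\<rangle> = \<langle>b ^ (p ^ s)\<rangle>\<close>. Then \<open>B\<close> is
  normal as well, so one may assume \<open>s \<le> t\<close>. Now some \<open>y \<in> A\<close> has \<open>y ^ (p ^ s) = b ^ (- p ^ s)\<close>, and
  since \<open>b\<close> and \<open>y\<close> commute modulo \<open>C\<close>, the element \<open>by\<close> satisfies \<open>(by) ^ (p ^ s) \<in> C\<close>; replacing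
  \<open>b\<close> by \<open>by\<close> shrinks \<open>A \<inter> B\<close>.
\<close>

section \<open>Congruence of words and conjugation of subgroups\<close>

lemma asum_eq_append:
  assumes "asum_eq G \<F> u u'" and "asum_eq G \<F> v v'"
  shows "asum_eq G \<F> (u @ v) (u' @ v')"
proof -
  have "asum_eq G \<F> ([] @ u @ v) ([] @ u' @ v)"
    using assms(1) by (rule asum_eq.ctxt)
  moreover have "asum_eq G \<F> (u' @ v @ []) (u' @ v' @ [])"
    using assms(2) by (rule asum_eq.ctxt)
  ultimately show ?thesis
    by (auto intro: asum_eq.trans)
qed

context group
begin

lemma inv_cancel_left [simp]:
  assumes "x \<in> carrier G" and "y \<in> carrier G"
  shows "inv x \<otimes> (x \<otimes> y) = y" and "x \<otimes> (inv x \<otimes> y) = y"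
  using assms by (simp_all flip: m_assoc)

lemma conj_subgroup_eq_image: "conj_subgroup G H x = (\<lambda>h. inv x \<otimes> h \<otimes> x) ` H"
  by (auto simp: conj_subgroup_def l_coset_def r_coset_def)

lemma conj_subgroup_conj_subgroup:
  assumes "H \<subseteq> carrier G" and "x \<in> carrier G" and "y \<in> carrier G"
  shows "conj_subgroup G (conj_subgroup G H x) y = conj_subgroup G H (x \<otimes> y)"
  unfolding conj_subgroup_eq_image image_image
  using assms by (intro image_cong) (auto simp: inv_mult_group m_assoc subset_iff)

lemma conj_subgroup_normal:
  assumes "N \<lhd> G" and "x \<in> carrier G"
  shows "conj_subgroup G N x = N"
proof
  interpret normal N G by fact
  show "conj_subgroup G N x \<subseteq> N"
    using assms inv_op_closed1 by (auto simp: conj_subgroup_eq_image)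
  show "N \<subseteq> conj_subgroup G N x"
  proof
    fix n assume n: "n \<in> N"
    then have "n = inv x \<otimes> (x \<otimes> n \<otimes> inv x) \<otimes> x"
      using assms by (simp add: m_assoc)
    moreover have "x \<otimes> n \<otimes> inv x \<in> N"
      using n assms inv_op_closed2 by blast
    ultimately show "n \<in> conj_subgroup G N x"
      unfolding conj_subgroup_eq_image by blast
  qed
qed

lemma conj_subgroup_self:
  assumes "subgroup H G" and "x \<in> H"
  shows "conj_subgroup G H x = H"
proof
  interpret subgroup H G by fact
  show "conj_subgroup G H x \<subseteq> H"
    using assms by (auto simp: conj_subgroup_eq_image)
  show "H \<subseteq> conj_subgroup G H x"
  proof
    fix n assume n: "n \<in> H"
    then have "n = inv x \<otimes> (x \<otimes> n \<otimes> inv x) \<otimes> x"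
      using assms by (simp add: m_assoc)
    moreover have "x \<otimes> n \<otimes> inv x \<in> H"
      using n assms by blast
    ultimately show "n \<in> conj_subgroup G H x"
      unfolding conj_subgroup_eq_image by blast
  qed
qed

lemma subgroup_conj_subgroup:
  assumes "subgroup H G" and "x \<in> carrier G"
  shows "subgroup (conj_subgroup G H x) G"
proof -
  interpret H: subgroup H G by fact
  show ?thesis
  proof (rule subgroupI)
    show "conj_subgroup G H x \<subseteq> carrier G"
      using assms by (auto simp: conj_subgroup_eq_image)
    show "conj_subgroup G H x \<noteq> {}"
      using H.one_closed unfolding conj_subgroup_eq_image by blast
  next
    fix y assume "y \<in> conj_subgroup G H x"
    then obtain h where h: "h \<in> H" "y = inv x \<otimes> h \<otimes> x"
      by (auto simp: conj_subgroup_eq_image)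
    then have "inv y = inv x \<otimes> inv h \<otimes> x"
      using assms by (simp add: inv_mult_group m_assoc)
    then show "inv y \<in> conj_subgroup G H x"
      using h by (auto simp: conj_subgroup_eq_image)
  next
    fix y z assume "y \<in> conj_subgroup G H x" "z \<in> conj_subgroup G H x"
    then obtain h k where h: "h \<in> H" "y = inv x \<otimes> h \<otimes> x" "k \<in> H" "z = inv x \<otimes> k \<otimes> x"
      by (auto simp: conj_subgroup_eq_image)
    then have "y \<otimes> z = inv x \<otimes> (h \<otimes> k) \<otimes> x"
      using assms by (simp add: m_assoc)
    then show "y \<otimes> z \<in> conj_subgroup G H x"
      using h by (auto simp: conj_subgroup_eq_image)
  qed
qed

section \<open>Rewriting words in the active sum\<close>

context
  fixes \<F> :: "'a set set"
  assumes family: "active_family G \<F>"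
begin

lemma family_subgroup: "F \<in> \<F> \<Longrightarrow> subgroup F G"
  using family by (simp add: active_family_def)

lemma family_conj: "F \<in> \<F> \<Longrightarrow> x \<in> carrier G \<Longrightarrow> conj_subgroup G F x \<in> \<F>"
  using family by (simp add: active_family_def)

lemma family_mem_carrier: "F \<in> \<F> \<Longrightarrow> x \<in> F \<Longrightarrow> x \<in> carrier G"
  using family_subgroup subgroup.mem_carrier by fast

lemma asum_eq_cancel:
  assumes "F \<in> \<F>" and "g \<in> F"
  shows "asum_eq G \<F> [(F, g), (F, inv g)] []" and "asum_eq G \<F> [(F, inv g), (F, g)] []"
proof -
  have F: "inv g \<in> F" "g \<in> carrier G"
    using assms family_subgroup family_mem_carrier subgroup.m_inv_closed by fast+
  show "asum_eq G \<F> [(F, g), (F, inv g)] []" "asum_eq G \<F> [(F, inv g), (F, g)] []"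
    using assms F asum_eq.mult[of F \<F> g "inv g" G] asum_eq.mult[of F \<F> "inv g" g G]
    by (auto intro: asum_eq.trans asum_eq.unit)
qed

text \<open>The conjugation relator in the form of a commutation rule. Inserting a cancelling pair
  from \<open>F\<close> in front and one from the conjugate factor behind exposes the relator, which
  then vanishes. A letter may thus pass another at the price of conjugating its factor.\<close>

lemma asum_eq_swap:
  assumes F: "F \<in> \<F>" "F' \<in> \<F>" and "h \<in> F" and "g \<in> F'"
  shows "asum_eq G \<F> [(F', g), (F, h)] [(F, h), (conj_subgroup G F' h, inv h \<otimes> g \<otimes> h)]"
proof -
  define F'' where "F'' = conj_subgroup G F' h"
  define k where "k = inv h \<otimes> g \<otimes> h"
  have F'': "F'' \<in> \<F>" "k \<in> F''"
    using assms family_conj family_mem_carrier by (auto simp: F''_def k_def conj_subgroup_eq_image)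
  have "asum_eq G \<F> ([(F, h), (F, inv h)] @ [(F', g), (F, h)] @ [(F'', inv k), (F'', k)])
                     ([] @ [(F', g), (F, h)] @ [])"
    using assms F'' by (intro asum_eq_append asum_eq.refl asum_eq_cancel)
  moreover have "asum_eq G \<F> ([(F, h)] @ [(F, inv h), (F', g), (F, h), (F'', inv k)] @ [(F'', k)])
                     ([(F, h)] @ [] @ [(F'', k)])"
    unfolding F''_def k_def using assms by (intro asum_eq.ctxt asum_eq.active)
  ultimately show ?thesis
    unfolding F''_def[symmetric] k_def[symmetric]
    using asum_eq.trans[OF asum_eq.sym] by simp
qed

end

section \<open>A criterion for a product of two subgroups\<close>

text \<open>The subgroups are arbitrary here, so \<open>meet\<close> asks explicitly that
  \<open>g\<close> normalises \<open>B\<close>; for cyclic factors of a finite group this is derived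
  from the commutator lying in \<open>B\<close>.\<close>

lemma is_active_sumI:
  assumes A: "A \<lhd> G" and B: "subgroup B G" and AB: "A <#> B = carrier G"
    and meet: "\<And>z. z \<in> A \<Longrightarrow> z \<in> B \<Longrightarrow>
      \<exists>g\<in>A. \<exists>b\<in>B. conj_subgroup G B g = B \<and> z = inv g \<otimes> inv b \<otimes> g \<otimes> b"
  shows "is_active_sum G ({A} \<union> {conj_subgroup G B x | x. x \<in> carrier G})"
proof -
  define \<F> where "\<F> = {A} \<union> {conj_subgroup G B x | x. x \<in> carrier G}"
  interpret A: normal A G by fact
  interpret B: subgroup B G by fact
  have sub_A: "subgroup A G"
    by (rule A.subgroup_axioms)
  have conj_B: "conj_subgroup G B x = B" if "x \<in> B" for x
    using conj_subgroup_self[OF B that] .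
  have conj_A: "conj_subgroup G A x = A" if "x \<in> carrier G" for x
    using conj_subgroup_normal[OF A that] .
  have "conj_subgroup G B \<one> \<in> \<F>"
    unfolding \<F>_def using one_closed by blast
  then have in_F: "A \<in> \<F>" "B \<in> \<F>"
    using conj_B[OF B.one_closed] by (simp_all add: \<F>_def)
  have product: "\<exists>x\<in>A. \<exists>y\<in>B. g = x \<otimes> y" if "g \<in> carrier G" for g
    using that unfolding AB[symmetric] set_mult_def by blast
  have family: "active_family G \<F>"
    unfolding active_family_def
  proof (intro conjI ballI)
    fix F assume "F \<in> \<F>"
    then show "subgroup F G"
      using sub_A subgroup_conj_subgroup[OF B] by (auto simp: \<F>_def)
    fix x assume "x \<in> carrier G"
    with \<open>F \<in> \<F>\<close> show "conj_subgroup G F x \<in> \<F>"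
      using conj_A conj_subgroup_conj_subgroup[OF B.subset] by (auto simp: \<F>_def)
  next
    have "g \<in> generate G (\<Union>\<F>)" if g: "g \<in> carrier G" for g
    proof -
      obtain x y where "x \<in> A" "y \<in> B" "g = x \<otimes> y"
        using product[OF g] by blast
      then show ?thesis
        using in_F by (blast intro: generate.eng generate.incl)
    qed
    moreover have "\<Union>\<F> \<subseteq> carrier G"
      using subgroup.subset[OF subgroup_conj_subgroup[OF B]] by (auto simp: \<F>_def)
    ultimately show "generate G (\<Union>\<F>) = carrier G"
      using generate_incl by blast
  qed
  note swap = asum_eq_swap[OF family]
  note cancel = asum_eq_cancel[OF family]
  note [trans] = asum_eq.trans

  \<comment> \<open>The swap rule read backwards: conjugating
    \<open>y \<otimes> x \<otimes> inv y\<close> by \<open>y\<close> gives back \<open>x\<close>,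
    and normality keeps the conjugated letter in the factor \<open>A\<close>.\<close>
  have move_A_left: "asum_eq G \<F> [(B, y), (A, x)] [(A, y \<otimes> x \<otimes> inv y), (B, y)]"
    if "x \<in> A" "y \<in> B" for x y
  proof -
    have "y \<otimes> x \<otimes> inv y \<in> A"
      using that A.inv_op_closed2 by simp
    moreover have "inv y \<otimes> (y \<otimes> x \<otimes> inv y) \<otimes> y = x"
      using that by (simp add: m_assoc)
    ultimately show ?thesis
      using swap[of B A y "y \<otimes> x \<otimes> inv y"] in_F that conj_A by (auto intro: asum_eq.sym)
  qed

  have letter: "\<exists>x\<in>A. \<exists>y\<in>B. \<exists>z\<in>A. g = x \<otimes> y \<otimes> z \<and> asum_eq G \<F> [(F, g)] [(A, x), (B, y), (A, z)]"
    if Fg: "F \<in> \<F>" "g \<in> F" for F g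
  proof (cases "F = A")
    case True
    have "asum_eq G \<F> [] [(B, \<one>)]"
      using in_F by (intro asum_eq.sym[OF asum_eq.unit])
    from asum_eq_append[OF asum_eq.refl this, of "[(F, g)]"]
    have "asum_eq G \<F> [(F, g)] [(F, g), (B, \<one>)]" by simp
    also have "asum_eq G \<F> \<dots> [(F, g), (B, \<one>), (A, \<one>)]"
      using asum_eq_append[OF asum_eq.refl asum_eq.sym[OF asum_eq.unit[OF in_F(1)]], of G "[(F, g), (B, \<one>)]"]
      by simp
    finally have "asum_eq G \<F> [(F, g)] [(A, g), (B, \<one>), (A, \<one>)]"
      using True by simp
    moreover have "g \<in> A" "g = g \<otimes> \<one> \<otimes> \<one>"
      using that True by auto
    ultimately show ?thesis
      using A.one_closed B.one_closed by blast
  next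
    case False
    then obtain u where u: "u \<in> carrier G" "F = conj_subgroup G B u"
      using Fg(1) unfolding \<F>_def by blast
    \<comment> \<open>Factoring the inverse of \<open>u\<close> gives
      \<open>u = inv y \<otimes> inv x\<close>. As \<open>B\<close> is fixed by conjugation with
      \<open>y\<close>, only \<open>inv x\<close> moves it, so the letter is the conjugate of a
      letter of \<open>B\<close> by a letter of \<open>A\<close>.\<close>
    obtain x y where xy: "x \<in> A" "y \<in> B" "inv u = x \<otimes> y"
      using product[of "inv u"] u by auto
    have "u = inv (x \<otimes> y)"
      using xy(3) u(1) by (metis inv_inv)
    then have "u = inv y \<otimes> inv x"
      using xy by (simp add: inv_mult_group)
    then have F: "F = conj_subgroup G B (inv x)"
      using u xy conj_subgroup_conj_subgroup[OF B.subset, of "inv y" "inv x"] conj_B[of "inv y"] by simp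
    then obtain h where h: "h \<in> B" "g = x \<otimes> h \<otimes> inv x"
      using Fg(2) xy by (auto simp: conj_subgroup_eq_image)
    have "asum_eq G \<F> ([] @ [(F, g)]) ([(A, x), (A, inv x)] @ [(F, g)])"
      using xy in_F by (intro asum_eq_append asum_eq.refl asum_eq.sym[OF cancel(1)])
    moreover have "asum_eq G \<F> ([(A, x)] @ [(A, inv x), (F, g)]) ([(A, x)] @ [(B, h), (A, inv x)])"
      using swap[of A B "inv x" h] xy h F in_F by (intro asum_eq_append asum_eq.refl) (auto intro: asum_eq.sym)
    ultimately have "asum_eq G \<F> [(F, g)] [(A, x), (B, h), (A, inv x)]"
      using asum_eq.trans by force
    then show ?thesis
      using xy h by blast
  qed

  have normal_form: "\<exists>x\<in>A. \<exists>y\<in>B. fp_eval G w = x \<otimes> y \<and> asum_eq G \<F> w [(A, x), (B, y)]"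
    if "fp_word \<F> w" for w
    using that
  proof (induction w)
    case Nil
    have "asum_eq G \<F> ([] @ []) ([(A, \<one>)] @ [(B, \<one>)])"
      using in_F by (intro asum_eq_append asum_eq.sym[OF asum_eq.unit])
    then show ?case
      by (intro bexI[of _ \<one>]) (auto simp: fp_eval_def)
  next
    case (Cons l w)
    obtain F g where l: "l = (F, g)" by fastforce
    have Fg: "F \<in> \<F>" "g \<in> F" and "fp_word \<F> w"
      using Cons.prems by (auto simp: l fp_word_def)
    with Cons.IH obtain x y where xy: "x \<in> A" "y \<in> B" "fp_eval G w = x \<otimes> y"
      "asum_eq G \<F> w [(A, x), (B, y)]"
      by blast
    obtain x1 y1 z1 where l1: "x1 \<in> A" "y1 \<in> B" "z1 \<in> A" "g = x1 \<otimes> y1 \<otimes> z1"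
      "asum_eq G \<F> [(F, g)] [(A, x1), (B, y1), (A, z1)]"
      using letter[OF Fg] by blast
    \<comment> \<open>The two adjacent letters \<open>z1\<close>, \<open>x\<close> of
      \<open>A\<close> are merged and carried left over \<open>y1\<close>; \<open>v\<close> is what
      they become.\<close>
    define v where "v = y1 \<otimes> (z1 \<otimes> x) \<otimes> inv y1"
    have v: "v \<in> A"
      using l1 xy A.inv_op_closed2[of y1 "z1 \<otimes> x"] by (simp add: v_def)
    have "asum_eq G \<F> ([l] @ w) ([(A, x1), (B, y1), (A, z1)] @ [(A, x), (B, y)])"
      unfolding l using l1 xy by (intro asum_eq_append)
    also have "asum_eq G \<F> \<dots> ([(A, x1), (B, y1)] @ [(A, z1 \<otimes> x)] @ [(B, y)])"
      using asum_eq.ctxt[OF asum_eq.mult[of A \<F> z1 x G], of "[(A, x1), (B, y1)]" "[(B, y)]"] in_F l1 xy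
      by simp
    also have "asum_eq G \<F> \<dots> ([(A, x1)] @ [(A, v), (B, y1)] @ [(B, y)])"
      using asum_eq.ctxt[OF move_A_left[of "z1 \<otimes> x" y1], of "[(A, x1)]" "[(B, y)]"] l1 xy
      by (simp add: v_def)
    also have "asum_eq G \<F> \<dots> ([(A, x1 \<otimes> v)] @ [(B, y1 \<otimes> y)])"
      using asum_eq_append[OF asum_eq.mult[of A \<F> x1 v G] asum_eq.mult[of B \<F> y1 y G]] in_F l1 xy v
      by simp
    finally have "asum_eq G \<F> (l # w) [(A, x1 \<otimes> v), (B, y1 \<otimes> y)]"
      by simp
    moreover have "fp_eval G (l # w) = g \<otimes> fp_eval G w"
      by (simp add: fp_eval_def l)
    then have "fp_eval G (l # w) = (x1 \<otimes> v) \<otimes> (y1 \<otimes> y)"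
      using l1 xy by (simp add: v_def m_assoc)
    ultimately show ?case
      using l1 xy v by blast
  qed

  text \<open>The word \<open>b\<^sup>-\<^sup>1 g b\<close> equals \<open>gz\<close> with \<open>z\<close> taken from \<open>A\<close> because \<open>A\<close> is normal, and with
    \<open>z\<close> taken from \<open>B\<close> because \<open>g\<close> normalises \<open>B\<close>.\<close>
  have identify: "asum_eq G \<F> [(A, z)] [(B, z)]" if z: "z \<in> A" "z \<in> B" for z
  proof -
    obtain g b where g: "g \<in> A" and b: "b \<in> B" and gB: "conj_subgroup G B g = B"
      and z_eq: "z = inv g \<otimes> inv b \<otimes> g \<otimes> b"
      using meet z by blast
    have bg: "inv g \<otimes> b \<otimes> g = b \<otimes> inv z" and gb: "inv b \<otimes> g \<otimes> b = g \<otimes> z"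
      using g b by (simp_all add: z_eq m_assoc inv_mult_group)
    have "asum_eq G \<F> ([(A, g)] @ []) ([(A, g)] @ [(B, b), (B, inv b)])"
      using in_F b by (intro asum_eq_append asum_eq.refl asum_eq.sym[OF cancel(1)])
    also have "asum_eq G \<F> \<dots> ([(B, b), (A, g \<otimes> z)] @ [(B, inv b)])"
      using asum_eq_append[OF swap[of B A b g] asum_eq.refl, of "[(B, inv b)]"] in_F b g gb conj_A by simp
    finally have "asum_eq G \<F> [(A, g)] [(B, b), (A, g \<otimes> z), (B, inv b)]" by simp
    from asum_eq.ctxt[OF this, of "[(B, inv b)]" "[(B, b)]"]
    have 1: "asum_eq G \<F> [(B, inv b), (A, g), (B, b)] [(B, inv b), (B, b), (A, g \<otimes> z), (B, inv b), (B, b)]"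
      by simp
    have "asum_eq G \<F> ([(B, inv b), (B, b)] @ [(A, g \<otimes> z)] @ [(B, inv b), (B, b)]) ([] @ [(A, g \<otimes> z)] @ [])"
      using in_F b by (intro asum_eq_append asum_eq.refl cancel(2))
    with 1 have A_form: "asum_eq G \<F> [(B, inv b), (A, g), (B, b)] [(A, g \<otimes> z)]"
      using asum_eq.trans by force

    \<comment> \<open>Since \<open>g\<close> normalises \<open>B\<close>, carrying \<open>g\<close>
      to the left leaves \<open>b \<otimes> inv z\<close> in the factor \<open>B\<close>; a letter
      \<open>(B, z)\<close> appended on the right then cancels \<open>inv z\<close>.\<close>
    have "asum_eq G \<F> [(B, b), (A, g)] ([(A, g)] @ [(B, b \<otimes> inv z)])"
      using swap[of A B g b] in_F b g bg gB by simp
    also have "asum_eq G \<F> \<dots> ([(A, g)] @ [(B, b), (B, inv z)])"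
      using in_F b z by (intro asum_eq_append asum_eq.refl asum_eq.sym[OF asum_eq.mult]) auto
    finally have "asum_eq G \<F> [(B, b), (A, g)] [(A, g), (B, b), (B, inv z)]" by simp
    from asum_eq.ctxt[OF this, of "[(B, inv b)]" "[(B, z)]"]
    have 2: "asum_eq G \<F> [(B, inv b), (B, b), (A, g), (B, z)] [(B, inv b), (A, g), (B, b), (B, inv z), (B, z)]"
      by simp
    have "asum_eq G \<F> ([(B, inv b), (A, g), (B, b)] @ [(B, inv z), (B, z)]) ([(A, g \<otimes> z)] @ [])"
      using in_F z by (intro asum_eq_append A_form cancel(2))
    then have "asum_eq G \<F> [(B, inv b), (A, g), (B, b), (B, inv z), (B, z)] [(A, g \<otimes> z)]"
      by simp
    with 2 have 3: "asum_eq G \<F> [(B, inv b), (B, b), (A, g), (B, z)] [(A, g \<otimes> z)]"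
      by (rule asum_eq.trans)
    have "asum_eq G \<F> ([] @ [(A, g), (B, z)]) ([(B, inv b), (B, b)] @ [(A, g), (B, z)])"
      using in_F b by (intro asum_eq_append asum_eq.refl asum_eq.sym[OF cancel(2)])
    then have "asum_eq G \<F> [(A, g), (B, z)] [(B, inv b), (B, b), (A, g), (B, z)]"
      by simp
    also note 3
    also have "asum_eq G \<F> [(A, g \<otimes> z)] [(A, g), (A, z)]"
      using in_F g z by (intro asum_eq.sym[OF asum_eq.mult])
    finally have "asum_eq G \<F> ([(A, inv g)] @ [(A, g), (B, z)]) ([(A, inv g)] @ [(A, g), (A, z)])"
      by (rule asum_eq_append[OF asum_eq.refl])
    moreover have "asum_eq G \<F> ([(A, inv g), (A, g)] @ u) ([] @ u)" for u
      using in_F g by (intro asum_eq_append asum_eq.refl cancel(2))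
    from this[of "[(A, z)]"] this[of "[(B, z)]"]
    have "asum_eq G \<F> [(A, inv g), (A, g), (A, z)] [(A, z)]"
      "asum_eq G \<F> [(A, inv g), (A, g), (B, z)] [(B, z)]" by simp_all
    ultimately show ?thesis
      using asum_eq.sym asum_eq.trans by (metis append_Cons append_Nil)
  qed

  have "asum_eq G \<F> w v"
    if w: "fp_word \<F> w" and v: "fp_word \<F> v" and eq: "fp_eval G w = fp_eval G v" for w v
  proof -
    obtain x y where xy: "x \<in> A" "y \<in> B" "fp_eval G w = x \<otimes> y" "asum_eq G \<F> w [(A, x), (B, y)]"
      using normal_form[OF w] by blast
    obtain x' y' where xy': "x' \<in> A" "y' \<in> B" "fp_eval G v = x' \<otimes> y'" "asum_eq G \<F> v [(A, x'), (B, y')]"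
      using normal_form[OF v] by blast
    \<comment> \<open>Equal values \<open>x \<otimes> y = x' \<otimes> y'\<close> give
      \<open>inv x' \<otimes> x = y' \<otimes> inv y\<close>, an element of both factors. The two
      normal forms differ only in the factor to which it is attached.\<close>
    define z where "z = inv x' \<otimes> x"
    have "x = x' \<otimes> y' \<otimes> inv y"
      using eq xy xy' by (simp add: inv_solve_right)
    then have z_eq: "z = y' \<otimes> inv y"
      unfolding z_def using xy xy' by (simp add: m_assoc)
    have z: "z \<in> A" and x_eq: "x = x' \<otimes> z"
      using xy xy' by (simp_all add: z_def)
    have "z \<in> B" and y'_eq: "y' = z \<otimes> y"
      unfolding z_eq using xy xy' by (simp_all add: m_assoc)
    note z = z this(1)
    note xy(4)
    also have "asum_eq G \<F> ([(A, x)] @ [(B, y)]) ([(A, x'), (A, z)] @ [(B, y)])"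
      unfolding x_eq using in_F xy' z by (intro asum_eq_append asum_eq.refl asum_eq.sym[OF asum_eq.mult])
    then have "asum_eq G \<F> [(A, x), (B, y)] [(A, x'), (A, z), (B, y)]" by simp
    also have "asum_eq G \<F> \<dots> [(A, x'), (B, z), (B, y)]"
      using asum_eq.ctxt[OF identify[OF z], of "[(A, x')]" "[(B, y)]"] by simp
    also have "asum_eq G \<F> ([(A, x')] @ [(B, z), (B, y)]) ([(A, x')] @ [(B, y')])"
      unfolding y'_eq using in_F xy z by (intro asum_eq_append asum_eq.refl asum_eq.mult)
    then have "asum_eq G \<F> [(A, x'), (B, z), (B, y)] [(A, x'), (B, y')]" by simp
    also note asum_eq.sym[OF xy'(4)]
    finally show ?thesis .
  qed
  with family show ?thesis
    unfolding is_active_sum_def \<F>_def[symmetric] by blast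
qed



section \<open>Powers, and commutators with a fixed element\<close>

lemma pow_inv_conj:
  assumes "x \<in> carrier G" and "g \<in> carrier G"
  shows "(inv g \<otimes> x \<otimes> g) [^] (n::nat) = inv g \<otimes> x [^] n \<otimes> g"
  using assms by (induction n) (simp_all add: m_assoc)

lemma pow_pow_fixed:
  assumes "x \<in> carrier G" and "x [^] (q::nat) = x"
  shows "x [^] (q ^ n) = x"
  by (induction n) (use assms in \<open>simp_all flip: nat_pow_pow\<close>)

text \<open>The exponents in question are the multiples of the least positive one, which divides
  \<open>p ^ m\<close> and so is a power of \<open>p\<close>. This replaces the chain of subgroups
  of a cyclic p-group: inclusions become comparisons of exponents.\<close>

lemma pow_mem_subgroup_iff_prime_power_dvd:
  fixes p :: nat
  assumes a: "a \<in> carrier G" and H: "subgroup H G"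
    and p: "Factorial_Ring.prime p" and order: "a [^] (p ^ m) = \<one>"
  obtains t where "\<And>n::nat. a [^] n \<in> H \<longleftrightarrow> p ^ t dvd n"
proof -
  interpret H: subgroup H G by fact
  define k where "k = (LEAST k::nat. 0 < k \<and> a [^] k \<in> H)"
  have "0 < p ^ m \<and> a [^] (p ^ m) \<in> H"
    using order H.one_closed p by (simp add: prime_gt_0_nat)
  then have "0 < k \<and> a [^] k \<in> H"
    unfolding k_def by (rule LeastI)
  then have k: "0 < k" "a [^] k \<in> H"
    by simp_all
  have pow_closed: "h [^] (n::nat) \<in> H" if "h \<in> H" for h n
    using that by (induction n) auto
  have iff: "a [^] n \<in> H \<longleftrightarrow> k dvd n" for n
  proof
    assume "k dvd n"
    then obtain j where "n = k * j" ..
    then have "a [^] n = (a [^] k) [^] j"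
      using a by (simp add: nat_pow_pow)
    then show "a [^] n \<in> H"
      using k pow_closed by simp
  next
    assume n: "a [^] n \<in> H"
    have "a [^] n = (a [^] k) [^] (n div k) \<otimes> a [^] (n mod k)"
      using a by (simp add: nat_pow_pow nat_pow_mult)
    then have "a [^] (n mod k) = inv ((a [^] k) [^] (n div k)) \<otimes> a [^] n"
      using a by simp
    then have "a [^] (n mod k) \<in> H"
      using n k pow_closed by simp
    then have "n mod k = 0"
      using k not_less_Least[of "n mod k" "\<lambda>k. 0 < k \<and> a [^] k \<in> H"]
      unfolding k_def[symmetric] by simp
    then show "k dvd n" by auto
  qed
  have "k dvd p ^ m"
    using iff order H.one_closed by metis
  then obtain t where "k = p ^ t"
    using p divides_primepow_nat by blast
  with iff that show ?thesis by blast
qed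

text \<open>Modulo \<open>C\<close> the elements \<open>b\<close> and \<open>y\<close> commute. As
  \<open>C\<close> is not assumed normal, no quotient is formed; the correction \<open>c\<close> is
  carried along next to the power of \<open>y\<close>, inside the abelian group
  \<open>A\<close>.\<close>

lemma mult_pow_mod_commutators:
  assumes A: "subgroup A G" and C: "subgroup C G" and CA: "C \<subseteq> A"
    and comm: "\<And>x y. x \<in> A \<Longrightarrow> y \<in> A \<Longrightarrow> x \<otimes> y = y \<otimes> x"
    and b: "b \<in> carrier G" and y: "y \<in> A"
    and commutators: "\<And>x. x \<in> A \<Longrightarrow> inv x \<otimes> inv b \<otimes> x \<otimes> b \<in> C"
  shows "\<exists>c\<in>C. (b \<otimes> y) [^] (n::nat) = b [^] n \<otimes> (y [^] n \<otimes> c)"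
proof -
  interpret A: subgroup A G by fact
  interpret C: subgroup C G by fact
  show ?thesis
  proof (induction n)
    case 0
    then show ?case
      using C.one_closed by (intro bexI[of _ \<one>]) auto
  next
    case (Suc n)
    then obtain c where c: "c \<in> C" "(b \<otimes> y) [^] n = b [^] n \<otimes> (y [^] n \<otimes> c)"
      by blast
    have yn: "y [^] n \<in> A"
      using y by (induction n) auto
    define w where "w = y [^] n \<otimes> c"
    have w: "w \<in> A"
      using yn c CA by (auto simp: w_def)
    \<comment> \<open>Moving the next \<open>b\<close> left over \<open>w\<close> costs exactly this
      commutator: \<open>w \<otimes> b = b \<otimes> w \<otimes> d\<close>.\<close>
    define d where "d = inv w \<otimes> inv b \<otimes> w \<otimes> b"
    have d: "d \<in> C"
      unfolding d_def by (rule commutators[OF w])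
    have carr: "w \<in> carrier G" "y \<in> carrier G" "c \<in> carrier G" "d \<in> carrier G"
      using w y c d by auto
    have "(b \<otimes> y) [^] Suc n = b [^] n \<otimes> w \<otimes> (b \<otimes> y)"
      using c by (simp add: w_def)
    also have "\<dots> = b [^] Suc n \<otimes> (y [^] n \<otimes> (c \<otimes> d \<otimes> y))"
      using b carr by (simp add: d_def w_def m_assoc inv_mult_group)
    also have "c \<otimes> d \<otimes> y = y \<otimes> (c \<otimes> d)"
      using c d y CA by (intro comm) auto
    also have "b [^] Suc n \<otimes> (y [^] n \<otimes> (y \<otimes> (c \<otimes> d))) = b [^] Suc n \<otimes> (y [^] Suc n \<otimes> (c \<otimes> d))"
      using b carr by (simp add: m_assoc)
    finally show ?case
      using c d by blast
  qed
qed

text \<open>On an abelian group \<open>A\<close> carried into itself by conjugation with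
  \<open>b\<close>, the map from \<open>x\<close> to \<open>[x, b]\<close> is a homomorphism, and
  this is its image.\<close>

lemma subgroup_commutators:
  assumes A: "subgroup A G"
    and comm: "\<And>x y. x \<in> A \<Longrightarrow> y \<in> A \<Longrightarrow> x \<otimes> y = y \<otimes> x"
    and b: "b \<in> carrier G" and conj: "\<And>x. x \<in> A \<Longrightarrow> inv b \<otimes> x \<otimes> b \<in> A"
  shows "subgroup ((\<lambda>x. inv x \<otimes> inv b \<otimes> x \<otimes> b) ` A) G"
proof -
  interpret A: subgroup A G by fact
  show ?thesis
  proof (rule subgroupI)
    show "(\<lambda>x. inv x \<otimes> inv b \<otimes> x \<otimes> b) ` A \<subseteq> carrier G"
      using b by auto
    show "(\<lambda>x. inv x \<otimes> inv b \<otimes> x \<otimes> b) ` A \<noteq> {}"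
      using A.one_closed by blast
  next
    fix k assume "k \<in> (\<lambda>x. inv x \<otimes> inv b \<otimes> x \<otimes> b) ` A"
    then obtain x where x: "x \<in> A" "k = inv x \<otimes> (inv b \<otimes> x \<otimes> b)"
      using b by (auto simp: m_assoc)
    then have "inv k = (inv b \<otimes> inv x \<otimes> b) \<otimes> x"
      using b by (simp add: m_assoc inv_mult_group)
    also have "\<dots> = x \<otimes> (inv b \<otimes> inv x \<otimes> b)"
      using x conj[of "inv x"] by (intro comm) auto
    also have "\<dots> = inv (inv x) \<otimes> inv b \<otimes> inv x \<otimes> b"
      using b x by (simp add: m_assoc)
    finally show "inv k \<in> (\<lambda>x. inv x \<otimes> inv b \<otimes> x \<otimes> b) ` A"
      using x by blast
  next
    fix k l assume "k \<in> (\<lambda>x. inv x \<otimes> inv b \<otimes> x \<otimes> b) ` A" "l \<in> (\<lambda>x. inv x \<otimes> inv b \<otimes> x \<otimes> b) ` A"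
    then obtain x y where x: "x \<in> A" "k = inv x \<otimes> (inv b \<otimes> x \<otimes> b)"
      and y: "y \<in> A" "l = inv y \<otimes> (inv b \<otimes> y \<otimes> b)"
      using b by (auto simp: m_assoc)
    have "k \<otimes> l = (inv x \<otimes> (inv b \<otimes> x \<otimes> b) \<otimes> inv y) \<otimes> (inv b \<otimes> y \<otimes> b)"
      using b x y by (simp add: m_assoc)
    also have "inv x \<otimes> (inv b \<otimes> x \<otimes> b) \<otimes> inv y = inv y \<otimes> (inv x \<otimes> (inv b \<otimes> x \<otimes> b))"
      using x y conj[of x] by (intro comm) auto
    also have "inv y \<otimes> (inv x \<otimes> (inv b \<otimes> x \<otimes> b)) \<otimes> (inv b \<otimes> y \<otimes> b)
        = inv (x \<otimes> y) \<otimes> inv b \<otimes> (x \<otimes> y) \<otimes> b"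
      using b x y by (simp add: m_assoc inv_mult_group)
    finally show "k \<otimes> l \<in> (\<lambda>x. inv x \<otimes> inv b \<otimes> x \<otimes> b) ` A"
      using x y by blast
  qed
qed

section \<open>Factorisations into two cyclic subgroups\<close>

definition cyclic_factors :: "'a \<Rightarrow> 'a \<Rightarrow> bool" where
  "cyclic_factors a b \<longleftrightarrow> a \<in> carrier G \<and> b \<in> carrier G \<and> generate G {a} \<lhd> G
     \<and> generate G {a} <#> generate G {b} = carrier G"

text \<open>Only the generator \<open>b\<close> occurs, not all of its powers. If \<open>a\<close>
  generates a normal subgroup, this set is a subgroup by
  \<open>subgroup_commutators\<close>.\<close>

definition commutators :: "'a \<Rightarrow> 'a \<Rightarrow> 'a set" where
  "commutators a b = (\<lambda>x. inv x \<otimes> inv b \<otimes> x \<otimes> b) ` generate G {a}"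

text \<open>Take a generator \<open>a\<close> of the normal subgroup and any lift \<open>b\<close>
  of a generator of the quotient.\<close>

lemma metacyclic_imp_cyclic_factors:
  assumes "metacyclic G"
  obtains a b where "cyclic_factors a b"
proof -
  obtain N where N: "N \<lhd> G" and cN: "cyclic_group (subgroup_generated G N)"
    and cQ: "cyclic_group (G Mod N)"
    using assms by (auto simp: metacyclic_def)
  interpret N: normal N G by fact
  interpret Q: group "G Mod N" by (rule N.factorgroup_is_group)
  interpret S: group "subgroup_generated G N" by simp
  have "carrier (subgroup_generated G N) = N"
    by (rule N.carrier_subgroup_generated_subgroup)
  with cN obtain a where a: "a \<in> N" "N = range (\<lambda>n::int. a [^]\<^bsub>subgroup_generated G N\<^esub> n)"
    using S.cyclic_group by auto
  then have N_eq: "N = generate G {a}"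
    using generate_pow[of a] by (auto simp: int_pow_subgroup_generated)
  obtain Y where Y: "Y \<in> carrier (G Mod N)"
    and Q_eq: "carrier (G Mod N) = range (\<lambda>n::int. Y [^]\<^bsub>G Mod N\<^esub> n)"
    using cQ Q.cyclic_group by auto
  obtain b where b: "b \<in> carrier G" "Y = N #> b"
    using Y by (auto simp: FactGroup_def RCOSETS_def)
  have "carrier G \<subseteq> N <#> generate G {b}"
  proof
    fix g assume g: "g \<in> carrier G"
    then have "N #> g \<in> carrier (G Mod N)"
      by (auto simp: FactGroup_def RCOSETS_def)
    then obtain n :: int where "N #> g = (N #> b) [^]\<^bsub>G Mod N\<^esub> n"
      using Q_eq b by auto
    then have "N #> g = N #> b [^] n"
      using N.FactGroup_int_pow b by simp
    then have "g \<in> N #> b [^] n"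
      using g N.subgroup_axioms rcos_self by metis
    then show "g \<in> N <#> generate G {b}"
      using generate_pow[of b] b by (auto simp: r_coset_def set_mult_def)
  qed
  moreover have "N <#> generate G {b} \<subseteq> carrier G"
    using b N.subset generate_incl[of "{b}"] by (intro set_mult_closed) auto
  ultimately have "cyclic_factors a b"
    using a b N N_eq by (auto simp: cyclic_factors_def)
  then show ?thesis by (rule that)
qed

lemma generate_singleton_commute:
  assumes "a \<in> carrier G" and "x \<in> generate G {a}" and "y \<in> generate G {a}"
  shows "x \<otimes> y = y \<otimes> x"
  using assms generate_pow[of a] by (auto simp: int_pow_mult add.commute simp flip: int_pow_mult)

lemma cyclic_factorsD:
  assumes "cyclic_factors a b"
  shows "a \<in> carrier G" "b \<in> carrier G" "generate G {a} \<lhd> G"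
    "generate G {a} <#> generate G {b} = carrier G"
    "subgroup (generate G {a}) G" "subgroup (generate G {b}) G"
    "a \<in> generate G {a}" "b \<in> generate G {b}"
  using assms by (auto simp: cyclic_factors_def intro: generate_is_subgroup generate.incl)

lemma pow_generate: "x \<in> generate G {a} \<Longrightarrow> a \<in> carrier G \<Longrightarrow> x [^] (n::nat) \<in> generate G {a}"
  using generate_is_subgroup[of "{a}"] by (induction n) (auto intro: subgroup.m_closed subgroup.one_closed)

text \<open>For \<open>g\<close> in the first factor, \<open>g \<otimes> b \<otimes> inv g\<close>
  is \<open>b\<close> times the inverse of \<open>[inv g, b]\<close>, hence lies in the second
  factor. So both factors normalise the second one, and their product is the whole group.\<close>

lemma cyclic_factors_swap:
  assumes fin: "finite (carrier G)" and ab: "cyclic_factors a b" and K: "commutators a b \<subseteq> generate G {b}"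
  shows "cyclic_factors b a"
proof -
  note D = cyclic_factorsD[OF ab]
  interpret A: subgroup "generate G {a}" G by (rule D)
  interpret B: subgroup "generate G {b}" G by (rule D)
  have conj_b: "g \<otimes> b \<otimes> inv g \<in> generate G {b}" if g: "g \<in> generate G {a}" for g
  proof -
    have "inv (inv g) \<otimes> inv b \<otimes> inv g \<otimes> b \<in> commutators a b"
      unfolding commutators_def using g by (intro imageI A.m_inv_closed)
    then have "inv (inv g) \<otimes> inv b \<otimes> inv g \<otimes> b \<in> generate G {b}"
      using K by blast
    then have "b \<otimes> inv (inv (inv g) \<otimes> inv b \<otimes> inv g \<otimes> b) \<in> generate G {b}"
      using D by blast
    also have "b \<otimes> inv (inv (inv g) \<otimes> inv b \<otimes> inv g \<otimes> b) = g \<otimes> b \<otimes> inv g"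
      using D g by (simp add: m_assoc inv_mult_group)
    finally show ?thesis .
  qed
  have conj_power: "g \<otimes> h \<otimes> inv g \<in> generate G {b}"
    if g: "g \<in> generate G {a}" and h: "h \<in> generate G {b}" for g h
  proof -
    obtain k :: nat where "h = b [^] k"
      using h unfolding generate_pow_on_finite_carrier[OF fin D(2)] by blast
    then have "g \<otimes> h \<otimes> inv g = (g \<otimes> b \<otimes> inv g) [^] k"
      using pow_inv_conj[of b "inv g" k] g D by simp
    then show ?thesis
      using pow_generate[OF conj_b[OF g] D(2)] by simp
  qed
  have "x \<otimes> h \<otimes> inv x \<in> generate G {b}" if x: "x \<in> carrier G" and h: "h \<in> generate G {b}" for x h
  proof -
    obtain g y where g: "g \<in> generate G {a}" and y: "y \<in> generate G {b}" and "x = g \<otimes> y"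
      using x unfolding D(4)[symmetric] by (auto simp: set_mult_def)
    then have "x \<otimes> h \<otimes> inv x = g \<otimes> (y \<otimes> h \<otimes> inv y) \<otimes> inv g"
      using h by (simp add: m_assoc inv_mult_group)
    then show ?thesis
      using conj_power[OF g, of "y \<otimes> h \<otimes> inv y"] y h by simp
  qed
  then have "generate G {b} \<lhd> G"
    using D(6) normal_inv_iff by blast
  moreover have "generate G {b} <#> generate G {a} = carrier G"
    using commut_normal[OF D(6) D(3)] D(4) by simp
  ultimately show ?thesis
    using D by (simp add: cyclic_factors_def)
qed

section \<open>Shrinking the intersection of the factors\<close>

text \<open>The element \<open>a ^ (p ^ (t + 1))\<close> generates the Frattini subgroup of the intersection of the factors.\<close>

lemma commutators_subset_frattini:
  fixes p :: nat
  assumes fin: "finite (carrier G)" and p: "Factorial_Ring.prime p" and order: "order G = p ^ m"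
    and ab: "cyclic_factors a b"
    and t: "\<And>n::nat. a [^] n \<in> generate G {b} \<longleftrightarrow> p ^ t dvd n"
    and not_sub: "\<not> generate G {a} \<inter> generate G {b} \<subseteq> commutators a b"
  shows "commutators a b \<subseteq> generate G {a [^] (p ^ Suc t)}"
    and "generate G {a [^] (p ^ Suc t)} \<subset> generate G {a} \<inter> generate G {b}"
proof -
  note D = cyclic_factorsD[OF ab]
  interpret A: normal "generate G {a}" G by (rule D)
  interpret B: subgroup "generate G {b}" G by (rule D)
  have A_pow: "generate G {a} = {a [^] k | k. k \<in> (UNIV :: nat set)}"
    using generate_pow_on_finite_carrier[OF fin D(1)] .
  have C_pow: "generate G {a [^] (p ^ Suc t)} = {(a [^] (p ^ Suc t)) [^] k | k. k \<in> (UNIV :: nat set)}"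
    using generate_pow_on_finite_carrier[OF fin] D(1) by blast
  have a_order: "a [^] (p ^ m) = \<one>"
    using pow_order_eq_1[OF D(1)] order by simp
  have K: "subgroup (commutators a b) G"
    unfolding commutators_def
    using D A.inv_op_closed1 generate_singleton_commute[OF D(1)]
    by (intro subgroup_commutators) blast+
  have KA: "commutators a b \<subseteq> generate G {a}"
    unfolding commutators_def
    using D A.inv_op_closed1 by (auto simp: m_assoc)
  obtain e where e: "\<And>n::nat. a [^] n \<in> commutators a b \<longleftrightarrow> p ^ e dvd n"
    using pow_mem_subgroup_iff_prime_power_dvd[OF D(1) K p a_order] by blast
  \<comment> \<open>\<open>p ^ e\<close> and \<open>p ^ t\<close> are the exponents of the
    commutators and of the intersection. As the intersection is not contained in the commutators,
    \<open>e\<close> exceeds \<open>t\<close>.\<close>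
  have "\<not> p ^ e dvd p ^ t"
  proof
    assume "p ^ e dvd p ^ t"
    then have "generate G {a} \<inter> generate G {b} \<subseteq> commutators a b"
      using e t dvd_trans by (auto simp: A_pow)
    with not_sub show False ..
  qed
  then have "Suc t \<le> e"
    using le_imp_power_dvd not_less_eq_eq by blast
  then have dvd: "p ^ Suc t dvd p ^ e"
    by (rule le_imp_power_dvd)
  show "commutators a b \<subseteq> generate G {a [^] (p ^ Suc t)}"
  proof
    fix z assume z: "z \<in> commutators a b"
    then obtain n :: nat where n: "z = a [^] n"
      using KA A_pow by blast
    then have "p ^ Suc t dvd n"
      using z e dvd dvd_trans by blast
    then obtain k where "n = p ^ Suc t * k" ..
    then have "z = (a [^] (p ^ Suc t)) [^] k"
      using n D by (simp add: nat_pow_pow)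
    then show "z \<in> generate G {a [^] (p ^ Suc t)}"
      using C_pow by blast
  qed
  have sub: "generate G {a [^] (p ^ Suc t)} \<subseteq> generate G {a} \<inter> generate G {b}"
    using D(1,5,6) pow_generate[OF D(7,1)] t by (intro Int_greatest generate_subgroup_incl) auto
  moreover have "generate G {a [^] (p ^ Suc t)} \<noteq> generate G {a} \<inter> generate G {b}"
  proof
    assume eq: "generate G {a [^] (p ^ Suc t)} = generate G {a} \<inter> generate G {b}"
    \<comment> \<open>\<open>x\<close> generates the intersection. If equality held,
      \<open>x\<close> would be a power of its own \<open>p\<close>-th power,
      \<open>x = x [^] (p * k)\<close>; iterating \<open>m\<close> times gives
      \<open>x = \<one>\<close>. A trivial intersection lies in the commutators, against
      \<open>not_sub\<close>.\<close>
    define x where "x = a [^] (p ^ t)"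
    have x: "x \<in> carrier G" using D by (simp add: x_def)
    have "x \<in> generate G {a} \<inter> generate G {b}"
      using pow_generate[OF D(7,1)] t by (simp add: x_def)
    then obtain k :: nat where "x = (a [^] (p ^ Suc t)) [^] k"
      unfolding eq[symmetric] C_pow by blast
    moreover have "x [^] (p * k) = (a [^] (p ^ Suc t)) [^] k"
      using D by (simp add: x_def nat_pow_pow ac_simps)
    ultimately have "x [^] (p * k) = x"
      by simp
    then have "x = x [^] ((p * k) ^ m)"
      using pow_pow_fixed x by simp
    also have "\<dots> = (x [^] (p ^ m)) [^] (k ^ m)"
      using x by (simp add: nat_pow_pow power_mult_distrib)
    also have "x [^] (p ^ m) = \<one>"
      using pow_order_eq_1[OF x] order by simp
    finally have x1: "x = \<one>" by simp
    have "z = \<one>" if z: "z \<in> generate G {a} \<inter> generate G {b}" for z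
    proof -
      obtain n :: nat where n: "z = a [^] n" using z A_pow by blast
      then have "p ^ t dvd n" using z t by blast
      then obtain j where "n = p ^ t * j" ..
      then have "z = x [^] j" using n D by (simp add: x_def nat_pow_pow)
      then show ?thesis using x1 by simp
    qed
    then show False
      using not_sub subgroup.one_closed[OF K] by blast
  qed
  ultimately show "generate G {a [^] (p ^ Suc t)} \<subset> generate G {a} \<inter> generate G {b}"
    by blast
qed

text \<open>Multiplying \<open>b\<close> by an element of the first factor leaves the product of the
  factors unchanged; that element is chosen to force the new intersection into \<open>C\<close>,
  which is strictly smaller than the old one.\<close>

lemma cyclic_factors_reduce:
  fixes p :: nat
  assumes fin: "finite (carrier G)" and p: "Factorial_Ring.prime p" and order: "order G = p ^ m"
    and ab: "cyclic_factors a b"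
    and t: "\<And>n::nat. a [^] n \<in> generate G {b} \<longleftrightarrow> p ^ t dvd n"
    and s: "\<And>n::nat. b [^] n \<in> generate G {a} \<longleftrightarrow> p ^ s dvd n"
    and "s \<le> t"
    and not_sub: "\<not> generate G {a} \<inter> generate G {b} \<subseteq> commutators a b"
  obtains b' where "cyclic_factors a b'"
    and "card (generate G {a} \<inter> generate G {b'}) < card (generate G {a} \<inter> generate G {b})"
proof -
  note D = cyclic_factorsD[OF ab]
  define C where "C = generate G {a [^] (p ^ Suc t)}"
  have KC: "commutators a b \<subseteq> C" and C_less: "C \<subset> generate G {a} \<inter> generate G {b}"
    unfolding C_def using commutators_subset_frattini[OF fin p order ab t not_sub] by blast+
  have C: "subgroup C G"
    unfolding C_def using D(1) by (intro generate_is_subgroup) auto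
  interpret A: normal "generate G {a}" G by (rule D)
  interpret B: subgroup "generate G {b}" G by (rule D)
  interpret C: subgroup C G by (rule C)
  have A_pow: "generate G {a} = {a [^] k | k. k \<in> (UNIV :: nat set)}"
    using generate_pow_on_finite_carrier[OF fin D(1)] .
  have "b [^] (p ^ s) \<in> generate G {a}"
    using s by simp
  then obtain n :: nat where n: "b [^] (p ^ s) = a [^] n"
    using A_pow by blast
  have "a [^] n \<in> generate G {b}"
    unfolding n[symmetric] using pow_generate D by blast
  \<comment> \<open>Here \<open>s \<le> t\<close> enters: \<open>p ^ s\<close> divides
    \<open>n\<close>, so \<open>b [^] (p ^ s)\<close> is a \<open>p ^ s\<close>-th power in the
    first factor. The inverse of such a root is \<open>y\<close>.\<close>
  then obtain u where "n = p ^ t * u"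
    using t by auto
  then have n_eq: "n = p ^ (t - s) * u * p ^ s"
    using \<open>s \<le> t\<close> by (simp add: algebra_simps flip: power_add)
  define y where "y = inv (a [^] (p ^ (t - s) * u))"
  have y: "y \<in> generate G {a}"
    using pow_generate D by (simp add: y_def)
  have y_pow: "y [^] (p ^ s) = inv (b [^] (p ^ s))"
    unfolding n n_eq y_def using D by (simp add: nat_pow_inv nat_pow_pow)
  define b' where "b' = b \<otimes> y"
  have b': "b' \<in> carrier G"
    using D y by (auto simp: b'_def)
  have b'_pow: "\<exists>c\<in>C. b' [^] k = b [^] k \<otimes> (y [^] k \<otimes> c)" for k :: nat
    unfolding b'_def
  proof (rule mult_pow_mod_commutators[OF D(5) C _ generate_singleton_commute[OF D(1)] D(2) y])
    show "C \<subseteq> generate G {a}"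
      using C_less by blast
    show "inv x \<otimes> inv b \<otimes> x \<otimes> b \<in> C" if "x \<in> generate G {a}" for x
      using that KC by (auto simp: commutators_def)
  qed
  have b'_mem: "\<exists>w\<in>generate G {a}. b' [^] k = b [^] k \<otimes> w" for k :: nat
  proof -
    obtain c where c: "c \<in> C" "b' [^] k = b [^] k \<otimes> (y [^] k \<otimes> c)"
      using b'_pow by blast
    moreover have "y [^] k \<otimes> c \<in> generate G {a}"
      using pow_generate[OF y D(1)] c C_less by blast
    ultimately show ?thesis by blast
  qed
  have "b' [^] (p ^ s) \<in> C"
    using b'_pow[of "p ^ s"] y_pow D by auto
  \<comment> \<open>Modulo the first factor \<open>b'\<close> equals \<open>b\<close>, so a power of
    \<open>b'\<close> in that factor has an exponent divisible by \<open>p ^ s\<close>; it is a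
    power of \<open>b' [^] (p ^ s)\<close>, an element of \<open>C\<close>.\<close>
  have meet: "generate G {a} \<inter> generate G {b'} \<subseteq> C"
  proof
    fix z assume z: "z \<in> generate G {a} \<inter> generate G {b'}"
    then obtain k :: nat where k: "z = b' [^] k"
      using generate_pow_on_finite_carrier[OF fin b'] by blast
    obtain w where w: "w \<in> generate G {a}" "b' [^] k = b [^] k \<otimes> w"
      using b'_mem by blast
    then have "b [^] k = z \<otimes> inv w"
      using k D z by (simp add: m_assoc)
    then have "b [^] k \<in> generate G {a}"
      using z w by simp
    then obtain j where "k = p ^ s * j"
      using s by auto
    then have "z = (b' [^] (p ^ s)) [^] j"
      using k b' by (simp add: nat_pow_pow)
    moreover have "(b' [^] (p ^ s)) [^] j \<in> C"
      using \<open>b' [^] (p ^ s) \<in> C\<close> by (induction j) auto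
    ultimately show "z \<in> C" by simp
  qed
  have "carrier G \<subseteq> generate G {a} <#> generate G {b'}"
  proof
    fix g assume "g \<in> carrier G"
    then obtain x h where x: "x \<in> generate G {a}" and h: "h \<in> generate G {b}" and g: "g = x \<otimes> h"
      unfolding D(4)[symmetric] by (auto simp: set_mult_def)
    obtain j :: nat where j: "h = b [^] j"
      using h generate_pow_on_finite_carrier[OF fin D(2)] by blast
    obtain w where w: "w \<in> generate G {a}" "b' [^] j = b [^] j \<otimes> w"
      using b'_mem by blast
    \<comment> \<open>The inverse of \<open>w\<close> carried left over \<open>b [^] j\<close>, so
      that \<open>b [^] j = v \<otimes> b' [^] j\<close>.\<close>
    define v where "v = b [^] j \<otimes> inv w \<otimes> inv (b [^] j)"
    have v: "v \<in> generate G {a}"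
      unfolding v_def using w D by (intro A.inv_op_closed2) auto
    have "g = (x \<otimes> v) \<otimes> b' [^] j"
      using w x D by (simp add: g j v_def m_assoc)
    moreover have "b' [^] j \<in> generate G {b'}"
      using pow_generate[of b'] b' by (auto intro: generate.incl)
    ultimately show "g \<in> generate G {a} <#> generate G {b'}"
      using x v by (auto simp: set_mult_def)
  qed
  moreover have "generate G {a} <#> generate G {b'} \<subseteq> carrier G"
    using b' generate_incl[of "{b'}"] A.subset by (intro set_mult_closed) auto
  ultimately have "cyclic_factors a b'"
    using D b' by (auto simp: cyclic_factors_def)
  moreover have "card (generate G {a} \<inter> generate G {b'}) < card (generate G {a} \<inter> generate G {b})"
  proof -
    have "finite (generate G {a} \<inter> generate G {b})"
      using fin A.subset by (meson finite_Int finite_subset)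
    then show ?thesis
      using meet C_less by (intro psubset_card_mono) auto
  qed
  ultimately show ?thesis by (rule that)
qed

lemma ex_cyclic_factors_meet_subset_commutators:
  fixes p :: nat
  assumes fin: "finite (carrier G)" and p: "Factorial_Ring.prime p" and order: "order G = p ^ m"
    and "metacyclic G"
  obtains a b where "cyclic_factors a b" and "generate G {a} \<inter> generate G {b} \<subseteq> commutators a b"
proof -
  define \<mu> where "\<mu> = (\<lambda>(a, b). card (generate G {a} \<inter> generate G {b}))"
  obtain a0 b0 where "cyclic_factors a0 b0"
    using metacyclic_imp_cyclic_factors[OF \<open>metacyclic G\<close>] .
  then have "\<exists>x. (case x of (a, b) \<Rightarrow> cyclic_factors a b) \<and>
      (\<forall>y. (case y of (a, b) \<Rightarrow> cyclic_factors a b) \<longrightarrow> \<mu> x \<le> \<mu> y)"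
    by (intro ex_has_least_nat[where k = "(a0, b0)"]) simp
  then obtain a b where ab: "cyclic_factors a b"
    and min: "\<And>a' b'. cyclic_factors a' b' \<Longrightarrow>
      card (generate G {a} \<inter> generate G {b}) \<le> card (generate G {a'} \<inter> generate G {b'})"
    unfolding \<mu>_def split_paired_Ex split_paired_All prod.case by blast
  note D = cyclic_factorsD[OF ab]
  have ord: "x [^] (p ^ m) = \<one>" if "x \<in> carrier G" for x
    using pow_order_eq_1[OF that] order by simp
  obtain t where t: "\<And>n::nat. a [^] n \<in> generate G {b} \<longleftrightarrow> p ^ t dvd n"
    using pow_mem_subgroup_iff_prime_power_dvd[OF D(1,6) p ord[OF D(1)]] by blast
  obtain s where s: "\<And>n::nat. b [^] n \<in> generate G {a} \<longleftrightarrow> p ^ s dvd n"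
    using pow_mem_subgroup_iff_prime_power_dvd[OF D(2,5) p ord[OF D(2)]] by blast
  show ?thesis
  proof (cases "generate G {a} \<inter> generate G {b} \<subseteq> commutators a b")
    case True
    with ab that show ?thesis by blast
  next
    case not_ab: False
    \<comment> \<open>The second factor becomes normal too, so \<open>a\<close> and \<open>b\<close>
      may trade places. The size of the intersection is symmetric, so minimality survives, and
      whichever of \<open>s\<close> and \<open>t\<close> is smaller, one of the two orders admits
      the reduction.\<close>
    have "commutators a b \<subseteq> generate G {b}"
      using commutators_subset_frattini[OF fin p order ab t not_ab] by blast
    with ab have ba: "cyclic_factors b a"
      by (rule cyclic_factors_swap[OF fin])
    show ?thesis
    proof (cases "generate G {b} \<inter> generate G {a} \<subseteq> commutators b a")
      case True
      with ba that show ?thesis by blast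
    next
      case not_ba: False
      show ?thesis
      proof (cases "s \<le> t")
        case True
        obtain b' where "cyclic_factors a b'"
          and "card (generate G {a} \<inter> generate G {b'}) < card (generate G {a} \<inter> generate G {b})"
          using cyclic_factors_reduce[OF fin p order ab t s True not_ab] .
        then show ?thesis
          using min[of a b'] by simp
      next
        case False
        then have "t \<le> s" by simp
        obtain a' where "cyclic_factors b a'"
          and "card (generate G {b} \<inter> generate G {a'}) < card (generate G {b} \<inter> generate G {a})"
          using cyclic_factors_reduce[OF fin p order ba s t \<open>t \<le> s\<close> not_ba] .
        then show ?thesis
          using min[of b a'] by (simp add: Int_commute)
      qed
    qed
  qed
qed

section \<open>From the factorisation to the active sum\<close>

text \<open>If \<open>z = [g, b]\<close> lies in the second factor, so does
  \<open>inv g \<otimes> b \<otimes> g = b \<otimes> inv z\<close>. Conjugation by \<open>g\<close>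
  thus maps that factor into itself, and onto itself by finiteness.\<close>

lemma is_active_sum_cyclic_factors:
  assumes fin: "finite (carrier G)" and ab: "cyclic_factors a b"
    and meet: "generate G {a} \<inter> generate G {b} \<subseteq> commutators a b"
  shows "is_active_sum G ({generate G {a}} \<union> {conj_subgroup G (generate G {b}) x | x. x \<in> carrier G})"
proof (rule is_active_sumI)
  note D = cyclic_factorsD[OF ab]
  show "generate G {a} \<lhd> G" "subgroup (generate G {b}) G"
    "generate G {a} <#> generate G {b} = carrier G"
    by (fact D)+
  interpret A: subgroup "generate G {a}" G by (rule D)
  interpret B: subgroup "generate G {b}" G by (rule D)
  fix z assume z: "z \<in> generate G {a}" "z \<in> generate G {b}"
  then obtain g where g: "g \<in> generate G {a}" and z_eq: "z = inv g \<otimes> inv b \<otimes> g \<otimes> b"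
    using meet by (auto simp: commutators_def)
  have "inv g \<otimes> b \<otimes> g = b \<otimes> inv z"
    using g D by (simp add: z_eq m_assoc inv_mult_group)
  then have conj_b: "inv g \<otimes> b \<otimes> g \<in> generate G {b}"
    using D z by simp
  have "inv g \<otimes> h \<otimes> g \<in> generate G {b}" if h: "h \<in> generate G {b}" for h
  proof -
    obtain k :: nat where "h = b [^] k"
      using h unfolding generate_pow_on_finite_carrier[OF fin D(2)] by blast
    then have "inv g \<otimes> h \<otimes> g = (inv g \<otimes> b \<otimes> g) [^] k"
      using g D by (simp add: pow_inv_conj)
    then show ?thesis
      using pow_generate[OF conj_b D(2)] by simp
  qed
  moreover have "inj_on (\<lambda>h. inv g \<otimes> h \<otimes> g) (generate G {b})"
    using g by (intro inj_onI) simp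
  moreover have "finite (generate G {b})"
    using fin B.subset by (rule rev_finite_subset)
  ultimately have "conj_subgroup G (generate G {b}) g = generate G {b}"
    unfolding conj_subgroup_eq_image by (intro endo_inj_surj) auto
  then show "\<exists>g\<in>generate G {a}. \<exists>b'\<in>generate G {b}.
      conj_subgroup G (generate G {b}) g = generate G {b} \<and> z = inv g \<otimes> inv b' \<otimes> g \<otimes> b'"
    using g z_eq D(8) by blast
qed

end

theorem theorem4p1:
  fixes G :: "('a, 'b) monoid_scheme" and p :: nat
  assumes "group G" and "finite (carrier G)" and "Factorial_Ring.prime p"
    and "\<exists>n. order G = p ^ n" and "metacyclic G"
  shows "\<exists>a\<in>carrier G. \<exists>b\<in>carrier G.
           generate G {a} \<lhd> G \<and>
           generate G {a} <#>\<^bsub>G\<^esub> generate G {b} = carrier G \<and>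
           is_active_sum G ({generate G {a}} \<union> {conj_subgroup G (generate G {b}) x | x. x \<in> carrier G})"
proof -
  interpret group G by fact
  obtain m where "order G = p ^ m"
    using assms(4) ..
  then obtain a b where ab: "cyclic_factors a b"
    and "generate G {a} \<inter> generate G {b} \<subseteq> commutators a b"
    using ex_cyclic_factors_meet_subset_commutators assms by metis
  then have "is_active_sum G ({generate G {a}} \<union> {conj_subgroup G (generate G {b}) x | x. x \<in> carrier G})"
    using is_active_sum_cyclic_factors assms(2) by blast
  with cyclic_factorsD[OF ab] show ?thesis by blast
qed

end
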